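(* Let $G$ be an amenable group and let $A$ be a finite alphabet. Then for every $\tau \in \mathrm{NUCA}_c(G,A)$, the following are equivalent: (i) there exists a nonempty open subset $U \subset A^G$ such that $\tau|_U$ is pre-injective; (ii) the image $\operatorname{Im}\tau = \tau(A^G)$ contains a nonempty open subset of $A^G$.
   Context: $A^G$ is the set of all maps (configurations) $x\colon G \to A$, equipped with the prodiscrete topology (product topology with each factor $A$ discrete). The shift action of $G$ on $A^G$ is $(gx)(h) = x(g^{-1}h)$. A group $G$ is amenable if it admits a Følner net, i.e. a family $(F_i)_{i\in I}$ of nonempty finite subsets of $G$ indexed by a directed set with $\lim_{i} |F_i \setminus F_i g|/|F_i| = 0$ for all $g \in G$. Given a subset $M \subset G$ (a memory), let $L = A^{A^M}$ be the set of all maps $A^M \to A$. For $s \in L^G$, the non-uniform cellular automaton (NUCA) $\sigma_s \colon A^G \to A^G$ is defined by $\sigma_s(x)(g) = s(g)\big((g^{-1}x)|_M\big)$ for $x \in A^G$, $g \in G$; $s$ is its configuration of local transition maps. $\mathrm{NUCA}_c(G,A)$ is the set of all NUCA $\sigma_s$ with finite memory $M$ for which $s$ is asymptotically constant, i.e. there is a constant configuration $c \in L^G$ and a finite set $E \subset G$ with $s|_{G\setminus E} = c|_{G \setminus E}$. Two configurations $x,y \in A^G$ are asymptotic if $x|_{G\setminus E} = y|_{G \setminus E}$ for some finite $E \subset G$. For $U \subset A^G$, $\tau|_U$ is pre-injective if for all asymptotic $x,y \in U$, $\tau(x)=\tau(y)$ implies $x=y$. *)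

theory Defs
  imports "HOL-Analysis.Function_Topology" "HOL-Algebra.Coset"
begin

definition directed_set :: "'i set \<Rightarrow> 'i rel \<Rightarrow> bool" where
  "directed_set I r \<longleftrightarrow> I \<noteq> {} \<and> preorder_on I r \<and>
     (\<forall>i\<in>I. \<forall>j\<in>I. \<exists>k\<in>I. (i, k) \<in> r \<and> (j, k) \<in> r)"

definition net_filter :: "'i set \<Rightarrow> 'i rel \<Rightarrow> 'i filter" where
  "net_filter I r = (INF i\<in>I. principal {j \<in> I. (i, j) \<in> r})"

lemma eventually_net_filter:
  assumes "directed_set I r"
  shows "eventually P (net_filter I r) \<longleftrightarrow> (\<exists>i\<in>I. \<forall>j\<in>I. (i, j) \<in> r \<longrightarrow> P j)"
proof -
  have "trans r" and ne: "I \<noteq> {}"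
    and up: "\<And>i j. i \<in> I \<Longrightarrow> j \<in> I \<Longrightarrow> \<exists>k\<in>I. (i, k) \<in> r \<and> (j, k) \<in> r"
    using assms by (auto simp: directed_set_def preorder_on_def)
  have "eventually P (net_filter I r) \<longleftrightarrow>
      (\<exists>i\<in>I. eventually P (principal {j \<in> I. (i, j) \<in> r}))"
    unfolding net_filter_def
  proof (rule eventually_INF_base[OF ne])
    fix a b assume "a \<in> I" "b \<in> I"
    then obtain k where k: "k \<in> I" "(a, k) \<in> r" "(b, k) \<in> r" using up by blast
    have "{j \<in> I. (k, j) \<in> r} \<subseteq> {j \<in> I. (a, j) \<in> r} \<inter> {j \<in> I. (b, j) \<in> r}"
      using k \<open>trans r\<close> by (auto dest: transD)
    with k show "\<exists>x\<in>I. principal {j \<in> I. (x, j) \<in> r}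
        \<le> inf (principal {j \<in> I. (a, j) \<in> r}) (principal {j \<in> I. (b, j) \<in> r})"
      by auto
  qed
  then show ?thesis by (auto simp: eventually_principal)
qed

definition folner_net :: "('g, 'b) monoid_scheme \<Rightarrow> 'i set \<Rightarrow> 'i rel \<Rightarrow> ('i \<Rightarrow> 'g set) \<Rightarrow> bool" where
  "folner_net G I r F \<longleftrightarrow> directed_set I r \<and>
     (\<forall>i\<in>I. F i \<noteq> {} \<and> finite (F i) \<and> F i \<subseteq> carrier G) \<and>
     (\<forall>g\<in>carrier G.
        ((\<lambda>i. real (card (F i - (F i #>\<^bsub>G\<^esub> g))) / real (card (F i))) \<longlongrightarrow> 0) (net_filter I r))"

text \<open>HOL cannot quantify over the type of the indices of a net inside a formula, so the index type
  is a parameter. In a theorem that assumes \<open>amenable TYPE('i) G\<close> with \<open>'i\<close> a type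
  variable, the hypothesis says that \<open>G\<close> has a Folner net indexed by a directed set in
  some type.\<close>

definition amenable :: "'i itself \<Rightarrow> ('g, 'b) monoid_scheme \<Rightarrow> bool" where
  "amenable TYPE('i) G \<longleftrightarrow> (\<exists>(I :: 'i set) r F. folner_net G I r F)"

definition configs :: "('g, 'b) monoid_scheme \<Rightarrow> 'a set \<Rightarrow> ('g \<Rightarrow> 'a) set" where
  "configs G A = (carrier G \<rightarrow>\<^sub>E A)"

definition prodiscrete :: "('g, 'b) monoid_scheme \<Rightarrow> 'a set \<Rightarrow> ('g \<Rightarrow> 'a) topology" where
  "prodiscrete G A = product_topology (\<lambda>_. discrete_topology A) (carrier G)"

lemma topspace_prodiscrete: "topspace (prodiscrete G A) = configs G A"
  by (simp add: prodiscrete_def configs_def)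

definition shift :: "('g, 'b) monoid_scheme \<Rightarrow> 'g \<Rightarrow> ('g \<Rightarrow> 'a) \<Rightarrow> 'g \<Rightarrow> 'a" where
  "shift G g x = (\<lambda>h\<in>carrier G. x (inv\<^bsub>G\<^esub> g \<otimes>\<^bsub>G\<^esub> h))"

definition local_maps :: "'g set \<Rightarrow> 'a set \<Rightarrow> (('g \<Rightarrow> 'a) \<Rightarrow> 'a) set" where
  "local_maps M A = ((M \<rightarrow>\<^sub>E A) \<rightarrow>\<^sub>E A)"

definition nuca ::
  "('g, 'b) monoid_scheme \<Rightarrow> 'a set \<Rightarrow> 'g set \<Rightarrow> ('g \<Rightarrow> ('g \<Rightarrow> 'a) \<Rightarrow> 'a) \<Rightarrow> ('g \<Rightarrow> 'a) \<Rightarrow> 'g \<Rightarrow> 'a" where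
  "nuca G A M s =
     (\<lambda>x\<in>configs G A. \<lambda>g\<in>carrier G. s g (restrict (shift G (inv\<^bsub>G\<^esub> g) x) M))"

definition asymptotic :: "('g, 'b) monoid_scheme \<Rightarrow> ('g \<Rightarrow> 'c) \<Rightarrow> ('g \<Rightarrow> 'c) \<Rightarrow> bool" where
  "asymptotic G x y \<longleftrightarrow>
     (\<exists>E. finite E \<and> E \<subseteq> carrier G \<and> restrict x (carrier G - E) = restrict y (carrier G - E))"

definition asymptotically_constant ::
  "('g, 'b) monoid_scheme \<Rightarrow> 'c set \<Rightarrow> ('g \<Rightarrow> 'c) \<Rightarrow> bool" where
  "asymptotically_constant G L s \<longleftrightarrow> (\<exists>l\<in>L. asymptotic G s (\<lambda>g\<in>carrier G. l))"

definition NUCA_c :: "('g, 'b) monoid_scheme \<Rightarrow> 'a set \<Rightarrow> (('g \<Rightarrow> 'a) \<Rightarrow> 'g \<Rightarrow> 'a) set" where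
  "NUCA_c G A = {nuca G A M s | M s. finite M \<and> M \<subseteq> carrier G \<and>
     s \<in> configs G (local_maps M A) \<and> asymptotically_constant G (local_maps M A) s}"

definition pre_injective_on ::
  "('g, 'b) monoid_scheme \<Rightarrow> (('g \<Rightarrow> 'a) \<Rightarrow> 'g \<Rightarrow> 'a) \<Rightarrow> ('g \<Rightarrow> 'a) set \<Rightarrow> bool" where
  "pre_injective_on G \<tau> U \<longleftrightarrow>
     (\<forall>x\<in>U. \<forall>y\<in>U. asymptotic G x y \<longrightarrow> \<tau> x = \<tau> y \<longrightarrow> x = y)"

lemma nuca_in_configs:
  assumes "group G" "M \<subseteq> carrier G" "s \<in> configs G (local_maps M A)" "x \<in> configs G A"
  shows "nuca G A M s x \<in> configs G A"
proof -
  interpret group G by fact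
  have "s g (restrict (shift G (inv\<^bsub>G\<^esub> g) x) M) \<in> A" if g: "g \<in> carrier G" for g
  proof -
    have "shift G (inv\<^bsub>G\<^esub> g) x h \<in> A" if "h \<in> M" for h
    proof -
      have "h \<in> carrier G" using that assms(2) by blast
      moreover have "x (g \<otimes>\<^bsub>G\<^esub> h) \<in> A"
        using assms(4) g \<open>h \<in> carrier G\<close> by (simp add: configs_def PiE_iff)
      ultimately show ?thesis using g by (simp add: shift_def)
    qed
    then have "restrict (shift G (inv\<^bsub>G\<^esub> g) x) M \<in> M \<rightarrow>\<^sub>E A"
      by (simp add: restrict_PiE_iff)
    moreover have "s g \<in> (M \<rightarrow>\<^sub>E A) \<rightarrow>\<^sub>E A"
      using assms(3) g unfolding configs_def local_maps_def by (rule PiE_mem)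
    ultimately show ?thesis by (rule PiE_mem[rotated])
  qed
  then show ?thesis using assms(4) by (simp add: nuca_def configs_def restrict_PiE_iff)
qed

lemma nuca_apply:
  assumes "group G" "M \<subseteq> carrier G" "x \<in> configs G A" "g \<in> carrier G"
  shows "nuca G A M s x g = s g (\<lambda>h\<in>M. x (g \<otimes>\<^bsub>G\<^esub> h))"
proof -
  interpret group G by fact
  have "restrict (shift G (inv\<^bsub>G\<^esub> g) x) M = (\<lambda>h\<in>M. x (g \<otimes>\<^bsub>G\<^esub> h))"
  proof (rule restrict_ext)
    fix h assume "h \<in> M"
    then have "h \<in> carrier G" using assms(2) by blast
    then show "shift G (inv\<^bsub>G\<^esub> g) x h = x (g \<otimes>\<^bsub>G\<^esub> h)"
      using assms(4) by (simp add: shift_def)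
  qed
  then show ?thesis using assms by (simp add: nuca_def)
qed

end

theory Submission
  imports Defs
begin

text \<open>Let \<open>\<sigma>\<close> be the cellular automaton whose rule is the asymptotic value of \<open>s\<close>. On an infinite
  group a pair of configurations violating pre-injectivity of \<open>\<sigma>\<close>, or a pattern missing from the image
  of \<open>\<sigma>\<close>, can be translated away from any finite set; a finite Baire argument and compactness give
  the converses, so (i) says that \<open>\<sigma>\<close> is pre-injective and (ii) that \<open>\<sigma>\<close> is surjective. These are
  equivalent by the Garden of Eden theorem, proved by counting on a single almost invariant set
  \<open>F\<close>: forbidding one pattern on a maximal packing of \<open>F\<close> by translates costs a factor exponentially
  small in \<open>card F\<close>, which beats the boundary terms. On a finite group both sides hold because
  points are open.\<close>

section \<open>Counting patterns on Folner sets\<close>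

text \<open>Induction on \<open>T\<close>, removing one block: a map on \<open>K\<close> is
  determined by its parts on \<open>P t\<close> and on \<open>K - P t\<close>, and the part on
  \<open>P t\<close> has one value fewer to choose from. The first conjunct certifies that the
  natural-number subtraction in the exponent is not truncated.\<close>

lemma card_avoiding_patterns:
  fixes P :: "'t \<Rightarrow> 'g set"
  assumes "finite A" "finite T" "finite K"
    and "\<And>t. t \<in> T \<Longrightarrow> P t \<subseteq> K" "\<And>t. t \<in> T \<Longrightarrow> card (P t) = d"
    and "\<And>t. t \<in> T \<Longrightarrow> p t \<in> P t \<rightarrow>\<^sub>E A"
    and "disjoint_family_on P T"
  shows "d * card T \<le> card K \<and>
    card {z \<in> K \<rightarrow>\<^sub>E A. \<forall>t\<in>T. restrict z (P t) \<noteq> p t}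
      \<le> (card A ^ d - 1) ^ card T * card A ^ (card K - d * card T)"
  using assms(2-)
proof (induction T arbitrary: K rule: finite_induct)
  case empty
  then show ?case by (simp add: card_PiE)
next
  case (insert t T)
  define K' where "K' = K - P t"
  define S where "S = {z \<in> K \<rightarrow>\<^sub>E A. \<forall>u\<in>insert t T. restrict z (P u) \<noteq> p u}"
  define S' where "S' = {z \<in> K' \<rightarrow>\<^sub>E A. \<forall>u\<in>T. restrict z (P u) \<noteq> p u}"
  define Q where "Q = (P t \<rightarrow>\<^sub>E A) - {p t}"
  have Pt: "P t \<subseteq> K" "card (P t) = d" "p t \<in> P t \<rightarrow>\<^sub>E A" "finite (P t)"
    using insert.prems by (auto intro: finite_subset)
  have disj: "P u \<inter> P t = {}" if "u \<in> T" for u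
    using insert.prems(5) insert.hyps that by (auto simp: disjoint_family_on_def)
  have sub: "P u \<subseteq> K'" if "u \<in> T" for u
    using insert.prems(2)[of u] disj[OF that] that by (auto simp: K'_def)
  have "d * card T \<le> card K' \<and>
      card S' \<le> (card A ^ d - 1) ^ card T * card A ^ (card K' - d * card T)"
    unfolding S'_def
  proof (rule insert.IH)
    show "finite K'" using insert.prems by (simp add: K'_def)
    show "disjoint_family_on P T"
      using insert.prems(5) by (rule disjoint_family_on_mono[rotated]) auto
  qed (use insert.prems sub in auto)
  then have IH: "d * card T \<le> card K'"
    "card S' \<le> (card A ^ d - 1) ^ card T * card A ^ (card K' - d * card T)" by auto
  have cK: "card K = card K' + d"
    using Pt insert.prems(1) card_mono[OF insert.prems(1) Pt(1)]
    by (simp add: K'_def card_Diff_subset)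
  have "finite (P t \<rightarrow>\<^sub>E A)" "finite (K' \<rightarrow>\<^sub>E A)"
    using Pt assms(1) insert.prems(1) by (auto simp: K'_def intro!: finite_PiE)
  moreover have "S' \<subseteq> (K' \<rightarrow>\<^sub>E A)" by (auto simp: S'_def)
  ultimately have "finite (P t \<rightarrow>\<^sub>E A)" "finite S'" by (auto intro: finite_subset)
  then have fin: "finite (Q \<times> S')" by (simp add: Q_def)
  have "inj_on (\<lambda>z. (restrict z (P t), restrict z K')) S"
  proof (rule inj_onI)
    fix z z' assume *: "z \<in> S" "z' \<in> S"
      "(restrict z (P t), restrict z K') = (restrict z' (P t), restrict z' K')"
    show "z = z'"
    proof (rule PiE_ext)
      show "z \<in> K \<rightarrow>\<^sub>E A" "z' \<in> K \<rightarrow>\<^sub>E A" using * by (auto simp: S_def)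
      fix k assume "k \<in> K"
      then show "z k = z' k"
        using *(3) by (cases "k \<in> P t") (auto simp: K'_def dest: fun_cong[of _ _ k])
    qed
  qed
  moreover have "(\<lambda>z. (restrict z (P t), restrict z K')) ` S \<subseteq> Q \<times> S'"
  proof clarify
    fix z assume z: "z \<in> S"
    then have zK: "z \<in> K \<rightarrow>\<^sub>E A" by (simp add: S_def)
    have "restrict (restrict z K') (P u) = restrict z (P u)" if "u \<in> T" for u
      using sub[OF that] by (auto simp: restrict_def fun_eq_iff)
    then show "restrict z (P t) \<in> Q \<and> restrict z K' \<in> S'"
      using z zK Pt(1) by (auto simp: S_def S'_def Q_def K'_def)
  qed
  ultimately have "card S \<le> card Q * card S'"
    using card_inj_on_le[OF _ _ fin] by (simp add: card_cartesian_product)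
  also have "card Q = card A ^ d - 1"
    using Pt by (simp add: Q_def card_PiE)
  also have "(card A ^ d - 1) * card S'
      \<le> (card A ^ d - 1) * ((card A ^ d - 1) ^ card T * card A ^ (card K' - d * card T))"
    using IH(2) by (rule mult_le_mono2)
  finally have "card S \<le> (card A ^ d - 1) ^ card (insert t T)
      * card A ^ (card K - d * card (insert t T))"
    using insert.hyps cK by (simp add: mult_ac)
  moreover have "d * card (insert t T) \<le> card K"
    using insert.hyps IH(1) cK by simp
  ultimately show ?case
    unfolding S_def by blast
qed

text \<open>Each \<open>g\<close> gives a bound that holds eventually along the net; as
  \<open>S\<close> is finite, one index serves all of its elements. Multiplying out the quotient
  gives the form used in counting.\<close>

lemma amenable_folner_set:
  assumes "amenable TYPE('i) G" "finite S" "S \<subseteq> carrier G" "0 < \<epsilon>"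
  obtains F where "finite F" "F \<noteq> {}" "F \<subseteq> carrier G"
    "\<And>g. g \<in> S \<Longrightarrow> real (card (F - (F #>\<^bsub>G\<^esub> g))) \<le> \<epsilon> * real (card F)"
proof -
  obtain I :: "'i set" and r F where net: "folner_net G I r F"
    using assms(1) by (auto simp: amenable_def)
  then have dir: "directed_set I r"
    and F: "\<And>i. i \<in> I \<Longrightarrow> F i \<noteq> {} \<and> finite (F i) \<and> F i \<subseteq> carrier G"
    by (auto simp: folner_net_def)
  have "eventually (\<lambda>i. real (card (F i - (F i #>\<^bsub>G\<^esub> g))) / real (card (F i)) < \<epsilon>)
      (net_filter I r)" if "g \<in> S" for g
    using net that assms(3,4) by (auto simp: folner_net_def intro: order_tendstoD(2))
  then have "eventually (\<lambda>i. \<forall>g\<in>S. real (card (F i - (F i #>\<^bsub>G\<^esub> g))) / real (card (F i)) < \<epsilon>)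
      (net_filter I r)"
    using assms(2) by (simp add: eventually_ball_finite)
  then obtain i where i: "i \<in> I"
    "\<And>j g. j \<in> I \<Longrightarrow> (i, j) \<in> r \<Longrightarrow> g \<in> S \<Longrightarrow>
       real (card (F j - (F j #>\<^bsub>G\<^esub> g))) / real (card (F j)) < \<epsilon>"
    by (auto simp: eventually_net_filter[OF dir])
  \<comment> \<open>Reflexivity puts \<open>i\<close> into its own tail, so \<open>F i\<close>
    itself is the desired set.\<close>
  have "(i, i) \<in> r"
    using dir i(1) by (auto simp: directed_set_def preorder_on_def refl_on_def)
  then have *: "real (card (F i - (F i #>\<^bsub>G\<^esub> g))) / real (card (F i)) < \<epsilon>" if "g \<in> S" for g
    using i that by blast
  have "0 < real (card (F i))" using F[OF i(1)] by (simp add: card_gt_0_iff)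
  then have "real (card (F i - (F i #>\<^bsub>G\<^esub> g))) \<le> \<epsilon> * real (card (F i))" if "g \<in> S" for g
    using *[OF that] by (simp add: field_simps)
  then show ?thesis using that F[OF i(1)] by blast
qed

section \<open>Packings by translates and boundary estimates in a group\<close>

context group
begin

lemma card_l_coset:
  assumes "g \<in> carrier G" "D \<subseteq> carrier G"
  shows "card (g <# D) = card D"
proof -
  have "g <# D = (\<lambda>h. g \<otimes> h) ` D" by (auto simp: l_coset_def)
  moreover have "inj_on (\<lambda>h. g \<otimes> h) D" 
    using assms by (intro inj_onI) (metis Units_l_cancel Units_eq subsetD)
  ultimately show ?thesis by (simp add: card_image)
qed

text \<open>Take \<open>T\<close> maximal among the packings and let \<open>B\<close> be the set of
  all admissible positions. By maximality every translate at a position in \<open>B\<close> meets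
  some \<open>t <# D\<close>, so \<open>B\<close> lies in the products
  \<open>t \<otimes> d \<otimes> inv e\<close> and is at most \<open>card D * card D\<close> times
  as large as \<open>T\<close>. An element of \<open>F\<close> outside \<open>B\<close> is pushed
  out of \<open>F\<close> by some \<open>d\<close>, and so is counted by a boundary term.\<close>

lemma maximal_packing:
  assumes "finite F" "F \<subseteq> carrier G" "finite D" "D \<subseteq> carrier G" "D \<noteq> {}"
  obtains T where "finite T" "T \<subseteq> carrier G" "\<And>t. t \<in> T \<Longrightarrow> t <# D \<subseteq> F"
    "disjoint_family_on (\<lambda>t. t <# D) T"
    "card F \<le> (\<Sum>d\<in>D. card (F - (F #> inv d))) + card D * card D * card T"
proof -
  define B where "B = {g \<in> carrier G. g <# D \<subseteq> F}"
  define \<T> where "\<T> = {T. T \<subseteq> B \<and> disjoint_family_on (\<lambda>t. t <# D) T}"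
  obtain d0 where d0: "d0 \<in> D" using assms by blast
  \<comment> \<open>A single element of \<open>D\<close> shows that \<open>B\<close> is finite,
    although \<open>carrier G\<close> may be infinite; hence there are finitely many packings and a
    maximal one exists.\<close>
  have "B \<subseteq> F #> inv d0"
  proof
    fix g assume "g \<in> B"
    then have g: "g \<in> carrier G" "g \<otimes> d0 \<in> F" using d0 by (auto simp: B_def l_coset_def)
    moreover have "g = (g \<otimes> d0) \<otimes> inv d0" using g d0 assms by (auto simp: m_assoc)
    ultimately show "g \<in> F #> inv d0" by (auto simp: r_coset_def)
  qed
  then have finB: "finite B" using assms by (auto simp: r_coset_def intro: finite_subset)
  then have "finite \<T>" by (auto simp: \<T>_def intro: finite_subset[of _ "Pow B"])
  moreover have "{} \<in> \<T>" by (simp add: \<T>_def disjoint_family_on_def)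
  ultimately obtain T where T: "T \<in> \<T>" and max: "\<And>T'. T' \<in> \<T> \<Longrightarrow> T \<subseteq> T' \<Longrightarrow> T = T'"
    using finite_has_maximal[of \<T>] by (metis empty_iff)
  have TB: "T \<subseteq> B" and dT: "disjoint_family_on (\<lambda>t. t <# D) T" using T by (auto simp: \<T>_def)
  have finT: "finite T" using TB finB by (rule finite_subset)
  have BT: "B \<subseteq> (\<lambda>(t, d, e). t \<otimes> d \<otimes> inv e) ` (T \<times> D \<times> D)"
  proof
    fix g assume g: "g \<in> B"
    then have gG: "g \<in> carrier G" by (simp add: B_def)
    have "\<exists>t\<in>T. (t <# D) \<inter> (g <# D) \<noteq> {}"
    proof (rule ccontr)
      assume *: "\<not> ?thesis"
      then have "insert g T \<in> \<T>"
        using g TB dT by (auto simp: \<T>_def disjoint_family_on_def)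
      \<comment> \<open>By maximality \<open>g\<close> already belongs to \<open>T\<close>, but its
        translate meets itself in \<open>g \<otimes> d0\<close>.\<close>
      then have "g \<in> T" using max by blast
      then show False using * d0 by (auto simp: l_coset_def)
    qed
    then obtain t d e where t: "t \<in> T" "d \<in> D" "e \<in> D" "t \<otimes> d = g \<otimes> e"
      by (auto simp: l_coset_def)
    then have "t \<in> carrier G" "d \<in> carrier G" "e \<in> carrier G"
      using TB assms by (auto simp: B_def)
    then have "g = t \<otimes> d \<otimes> inv e" using t gG by (simp add: m_assoc)
    then show "g \<in> (\<lambda>(t, d, e). t \<otimes> d \<otimes> inv e) ` (T \<times> D \<times> D)" using t by force
  qed
  have "card B \<le> card (T \<times> D \<times> D)"
    using BT finT assms by (meson card_image_le card_mono finite_SigmaI finite_imageI le_trans)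
  then have cB: "card B \<le> card D * card D * card T"
    by (simp add: card_cartesian_product mult_ac)
  have "F \<subseteq> (\<Union>d\<in>D. F - (F #> inv d)) \<union> B"
  proof
    fix g assume g: "g \<in> F"
    then have gG: "g \<in> carrier G" using assms by blast
    show "g \<in> (\<Union>d\<in>D. F - (F #> inv d)) \<union> B"
    proof (rule ccontr)
      assume *: "g \<notin> (\<Union>d\<in>D. F - (F #> inv d)) \<union> B"
      then obtain d where d: "d \<in> D" "g \<otimes> d \<notin> F" using gG by (auto simp: B_def l_coset_def)
      with * g obtain f where f: "f \<in> F" "g = f \<otimes> inv d" by (auto simp: r_coset_def)
      have "f \<in> carrier G" "d \<in> carrier G" using f d assms by auto
      then have "g \<otimes> d = f" by (simp add: f m_assoc)
      then show False using d f by simp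
    qed
  qed
  then have "card F \<le> card ((\<Union>d\<in>D. F - (F #> inv d)) \<union> B)"
    using assms finB by (intro card_mono) auto
  also have "\<dots> \<le> card (\<Union>d\<in>D. F - (F #> inv d)) + card B" by (rule card_Un_le)
  also have "\<dots> \<le> (\<Sum>d\<in>D. card (F - (F #> inv d))) + card D * card D * card T"
    using assms cB by (intro add_mono card_UN_le) auto
  finally show thesis using that[of T] finT TB dT by (auto simp: B_def)
qed

text \<open>Right multiplication by \<open>m\<close> is a bijection between the two sets. It turns
  the growth of \<open>F\<close> under multiplication by \<open>m\<close> into a Folner defect,
  which invariance controls.\<close>

lemma card_r_coset_diff:
  assumes "finite F" "F \<subseteq> carrier G" "m \<in> carrier G"
  shows "card ((F #> m) - F) = card (F - (F #> inv m))"
proof -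
  have "bij_betw (\<lambda>g. g \<otimes> m) (F - (F #> inv m)) ((F #> m) - F)"
  proof (rule bij_betw_byWitness[where f' = "\<lambda>g. g \<otimes> inv m"])
    show "\<forall>a\<in>F - (F #> inv m). a \<otimes> m \<otimes> inv m = a"
      using assms by (auto simp: m_assoc)
    show "\<forall>a\<in>(F #> m) - F. a \<otimes> inv m \<otimes> m = a"
      using assms by (auto simp: m_assoc r_coset_def)
    show "(\<lambda>g. g \<otimes> m) ` (F - (F #> inv m)) \<subseteq> (F #> m) - F"
    proof clarify
      fix g assume g: "g \<in> F" "g \<notin> F #> inv m"
      have "g = g \<otimes> m \<otimes> inv m" using g assms by (auto simp: m_assoc)
      then have "g \<otimes> m \<notin> F" using g by (auto simp: r_coset_def)
      then show "g \<otimes> m \<in> (F #> m) - F" using g by (auto simp: r_coset_def)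
    qed
    show "(\<lambda>g. g \<otimes> inv m) ` ((F #> m) - F) \<subseteq> F - (F #> inv m)"
    proof clarify
      fix g assume g: "g \<in> F #> m" "g \<notin> F"
      then obtain f where f: "f \<in> F" "g = f \<otimes> m" by (auto simp: r_coset_def)
      then have gf: "g \<otimes> inv m = f" "g \<in> carrier G" using assms by (auto simp: m_assoc)
      have "f \<notin> F #> inv m"
      proof
        assume "f \<in> F #> inv m"
        then obtain h where h: "h \<in> F" "f = h \<otimes> inv m" by (auto simp: r_coset_def)
        then have "g = h" using f assms by (auto simp: m_assoc)
        then show False using g h by simp
      qed
      then show "g \<otimes> inv m \<in> F - (F #> inv m)" using gf f by simp
    qed
  qed
  then show ?thesis by (metis bij_betw_same_card)
qed

text \<open>On a sufficiently invariant set \<open>F\<close>, the loss caused by the forbidden patterns on a packing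
  of \<open>F\<close> by translates of \<open>D\<close> outweighs the gain from enlarging \<open>F\<close> by its
  \<open>N\<close>-neighbourhood.\<close>

lemma packing_entropy_gap:
  fixes a :: nat
  assumes "amenable TYPE('i) G" "finite D" "D \<subseteq> carrier G" "D \<noteq> {}"
    and "finite N" "N \<subseteq> carrier G" "0 < a"
  obtains F T where "finite F" "F \<subseteq> carrier G" "finite T" "T \<subseteq> carrier G"
    "\<And>t. t \<in> T \<Longrightarrow> t <# D \<subseteq> F" "disjoint_family_on (\<lambda>t. t <# D) T"
    "(a ^ card D - 1) ^ card T * a ^ (card (F \<union> (F <#> N)) - card D * card T) < a ^ card F"
proof -
  define d where "d = card D"
  \<comment> \<open>The proportion of patterns on a block that survives when one of them is
    forbidden.\<close>
  define \<beta> where "\<beta> = (real a ^ d - 1) / real a ^ d"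
  have d: "0 < d" using assms by (simp add: d_def card_gt_0_iff)
  have ad: "1 \<le> real a ^ d" using assms by simp
  then have \<beta>: "0 \<le> \<beta>" "\<beta> < 1" using assms by (auto simp: \<beta>_def divide_less_eq)
  have "0 < 1 / real a" using assms by simp
  \<comment> \<open>Forbidding a pattern on \<open>k\<close> blocks outweighs the freedom gained
    from one additional cell.\<close>
  then obtain k where "\<beta> ^ k < 1 / real a" using real_arch_pow_inv \<beta> by blast
  then have k: "real a * \<beta> ^ k < 1" using assms by (simp add: field_simps)
  define n where "n = card N"
  \<comment> \<open>Chosen for two purposes: the boundary terms of the packing take at most half of
    \<open>F\<close>, so \<open>card F\<close> is at most \<open>2 * d * d * card T\<close>; and
    then \<open>k\<close> times the number \<open>e\<close> of additional cells is at most
    \<open>card T\<close>. The summands \<open>1\<close> keep the denominator nonzero when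
    \<open>k\<close> or \<open>n\<close> vanishes.\<close>
  define \<epsilon> where "\<epsilon> = 1 / (2 * real d * real d * (real k + 1) * (real n + 1))"
  have \<epsilon>: "0 < \<epsilon>" using d by (simp add: \<epsilon>_def)
  \<comment> \<open>Invariance is requested under inverses because both
    \<open>maximal_packing\<close> and \<open>card_r_coset_diff\<close> produce the defects of
    \<open>inv d\<close> and \<open>inv m\<close>.\<close>
  obtain F where F: "finite F" "F \<noteq> {}" "F \<subseteq> carrier G"
    and inva: "\<And>g. g \<in> m_inv G ` (D \<union> N) \<Longrightarrow> real (card (F - (F #> g))) \<le> \<epsilon> * real (card F)"
  proof (rule amenable_folner_set[OF assms(1) _ _ \<epsilon>, of "m_inv G ` (D \<union> N)"])
    show "finite (m_inv G ` (D \<union> N))" "m_inv G ` (D \<union> N) \<subseteq> carrier G" using assms by auto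
  qed blast
  have f0: "0 < real (card F)" using F by (simp add: card_gt_0_iff)
  obtain T where T: "finite T" "T \<subseteq> carrier G" "\<And>t. t \<in> T \<Longrightarrow> t <# D \<subseteq> F"
    "disjoint_family_on (\<lambda>t. t <# D) T"
    and cF: "card F \<le> (\<Sum>x\<in>D. card (F - (F #> inv x))) + d * d * card T"
    using maximal_packing[OF F(1,3) assms(2-4)] unfolding d_def by blast
  define e where "e = card ((F <#> N) - F)"
  have "real (card F) \<le> real ((\<Sum>x\<in>D. card (F - (F #> inv x))) + d * d * card T)"
    using cF by (rule of_nat_mono)
  also have "\<dots> = (\<Sum>x\<in>D. real (card (F - (F #> inv x)))) + real d * real d * real (card T)" by simp
  also have "(\<Sum>x\<in>D. real (card (F - (F #> inv x)))) \<le> (\<Sum>x\<in>D. \<epsilon> * real (card F))"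
    using inva by (intro sum_mono) auto
  finally have "real (card F) \<le> real d * \<epsilon> * real (card F) + real d * real d * real (card T)"
    by (simp add: d_def)
  moreover have "real d * \<epsilon> \<le> 1 / 2"
  proof -
    have "1 * (1 * 1) \<le> real d * ((real k + 1) * (real n + 1))"
      using d by (intro mult_mono) auto
    moreover have "real d * \<epsilon> = 1 / (2 * (real d * ((real k + 1) * (real n + 1))))"
      using d by (simp add: \<epsilon>_def)
    ultimately show ?thesis by (simp add: divide_le_eq)
  qed
  then have "real d * \<epsilon> * real (card F) \<le> 1 / 2 * real (card F)"
    using f0 by (intro mult_right_mono) auto
  ultimately have cT: "real (card F) \<le> 2 * real d * real d * real (card T)" by linarith
  have T0: "0 < card T" 
    using cT f0 by (cases "card T = 0") auto
  have "(F <#> N) - F = (\<Union>m\<in>N. (F #> m) - F)" by (auto simp: set_mult_def r_coset_def)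
  then have "e = card (\<Union>m\<in>N. (F #> m) - F)" by (simp only: e_def)
  also have "\<dots> \<le> (\<Sum>m\<in>N. card ((F #> m) - F))"
    using assms(5) by (rule card_UN_le)
  also have "(\<Sum>m\<in>N. card ((F #> m) - F)) = (\<Sum>m\<in>N. card (F - (F #> inv m)))"
    using assms F by (intro sum.cong card_r_coset_diff) auto
  finally have "real e \<le> (\<Sum>m\<in>N. real (card (F - (F #> inv m))))"
    by (metis of_nat_mono of_nat_sum)
  also have "\<dots> \<le> (\<Sum>m\<in>N. \<epsilon> * real (card F))"
    using inva by (intro sum_mono) auto
  finally have e1: "real e \<le> real n * \<epsilon> * real (card F)" by (simp add: n_def)
  have "real k * real e \<le> real k * (real n * \<epsilon> * real (card F))"
    using e1 by (intro mult_left_mono) auto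
  also have "\<dots> \<le> real k * (real n * \<epsilon> * (2 * real d * real d * real (card T)))"
    using cT \<epsilon> by (intro mult_left_mono) auto
  also have "\<dots> = (real k * real n) * (\<epsilon> * (2 * real d * real d)) * real (card T)"
    by (simp add: mult_ac)
  also have "\<epsilon> * (2 * real d * real d) = 1 / ((real k + 1) * (real n + 1))"
    using d by (simp add: \<epsilon>_def)
  also have "real k * real n * (1 / ((real k + 1) * (real n + 1))) * real (card T)
      \<le> 1 * real (card T)"
  proof (intro mult_right_mono)
    have "0 < (real k + 1) * (real n + 1)" by simp
    moreover have "real k * real n \<le> 1 * ((real k + 1) * (real n + 1))"
      by (simp add: algebra_simps)
    ultimately show "real k * real n * (1 / ((real k + 1) * (real n + 1))) \<le> 1"
      by (simp only: pos_divide_le_eq times_divide_eq_right mult_1_right)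
  qed simp
  finally have "real (k * e) \<le> real (card T)" by simp
  then have ke: "k * e \<le> card T" by linarith
  have gap: "real a ^ e * \<beta> ^ card T < 1"
  \<comment> \<open>Without additional cells the strict inequality comes from \<open>T\<close> being
    nonempty; otherwise it comes from the choice of \<open>k\<close>.\<close>
  proof (cases "e = 0")
    case True
    then show ?thesis using \<beta> T0 by (simp add: power_less_one_iff)
  next
    case False
    have "real a ^ e * \<beta> ^ card T \<le> real a ^ e * \<beta> ^ (k * e)"
      using ke \<beta> by (intro mult_left_mono power_decreasing) auto
    also have "\<dots> = (real a * \<beta> ^ k) ^ e" by (simp add: power_mult_distrib power_mult)
    also have "\<dots> < 1" using False k \<beta> by (simp add: power_less_one_iff)
    finally show ?thesis .
  qed
  have cl: "card (t <# D) = d" if "t \<in> T" for t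
    using card_l_coset[of t D] that T assms by (auto simp: d_def)
  have "card (\<Union>t\<in>T. t <# D) = (\<Sum>t\<in>T. card (t <# D))"
    using T(1,4) finite_subset[OF T(3) F(1)]
    by (intro card_UN_disjoint) (auto simp: disjoint_family_on_def)
  \<comment> \<open>The blocks are disjoint inside \<open>F\<close>, so the exponent below is a true
    difference and the powers of \<open>a\<close> can be recombined.\<close>
  then have "d * card T \<le> card F"
    using cl card_mono[OF F(1) UN_least, of T "\<lambda>t. t <# D", OF T(3)] by (simp add: mult.commute)
  have cFN: "card (F \<union> (F <#> N)) = card F + e"
  proof -
    have "F <#> N = (\<Union>m\<in>N. F #> m)" by (auto simp: set_mult_def r_coset_def)
    then have "finite (F <#> N)" using F assms by (auto simp: r_coset_def)
    then show ?thesis using F(1) card_Un_disjoint[of F "(F <#> N) - F"] by (simp add: e_def)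
  qed
  have "real ((a ^ d - 1) ^ card T * a ^ (card F + e - d * card T))
      = (real a ^ d - 1) ^ card T * real a ^ (card F + e - d * card T)"
    using assms by (simp add: of_nat_diff)
  also have "\<dots> = \<beta> ^ card T * (real a ^ (d * card T) * real a ^ (card F + e - d * card T))"
    using assms by (simp add: \<beta>_def power_divide power_mult)
  also have "real a ^ (d * card T) * real a ^ (card F + e - d * card T) = real a ^ card F * real a ^ e"
    using \<open>d * card T \<le> card F\<close> by (simp flip: power_add)
  also have "\<beta> ^ card T * (real a ^ card F * real a ^ e)
      = real a ^ card F * (real a ^ e * \<beta> ^ card T)" by simp
  also have "\<dots> < real a ^ card F * 1"
    using gap assms by (intro mult_strict_left_mono) auto
  finally have "real ((a ^ d - 1) ^ card T * a ^ (card F + e - d * card T)) < real (a ^ card F)"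
    by simp
  then have "(a ^ d - 1) ^ card T * a ^ (card F + e - d * card T) < a ^ card F"
    by (simp only: of_nat_less_iff)
  then show thesis using that[OF F(1,3) T] cFN by (simp add: d_def)
qed

text \<open>The elements to be avoided are the products \<open>k \<otimes> inv d\<close>, of which
  there are finitely many.\<close>

lemma infinite_translate_disjoint:
  assumes "infinite (carrier G)" "finite D" "D \<subseteq> carrier G" "finite K"
  obtains g where "g \<in> carrier G" "\<And>d. d \<in> D \<Longrightarrow> g \<otimes> d \<notin> K"
proof -
  have "finite ((\<lambda>(k, d). k \<otimes> inv d) ` (K \<times> D))" using assms by auto
  then obtain g where g: "g \<in> carrier G" "g \<notin> (\<lambda>(k, d). k \<otimes> inv d) ` (K \<times> D)"
    using assms(1) by (metis finite_subset subsetI)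
  have "g \<otimes> d \<notin> K" if "d \<in> D" for d
  proof
    assume "g \<otimes> d \<in> K"
    moreover have "g = (g \<otimes> d) \<otimes> inv d" using g that assms by (auto simp: m_assoc)
    ultimately show False using g(2) that by force
  qed
  then show thesis using that g by blast
qed

end

section \<open>Cylinders and compactness\<close>

definition cylinder :: "('g, 'b) monoid_scheme \<Rightarrow> 'a set \<Rightarrow> 'g set \<Rightarrow> ('g \<Rightarrow> 'a) \<Rightarrow> ('g \<Rightarrow> 'a) set" where
  "cylinder G A F x = {y \<in> configs G A. \<forall>g\<in>F. y g = x g}"

lemma openin_cylinder:
  assumes "finite F" "F \<subseteq> carrier G" "x \<in> configs G A"
  shows "openin (prodiscrete G A) (cylinder G A F x)"
proof -
  \<comment> \<open>The cylinder is a product box with a singleton factor at each cell of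
    \<open>F\<close> and the full alphabet elsewhere.\<close>
  define U where "U g = (if g \<in> F then {x g} else A)" for g
  have xA: "x g \<in> A" if "g \<in> carrier G" for g
    using assms(3) that by (auto simp: configs_def)
  then have UA: "U g \<subseteq> A" if "g \<in> carrier G" for g using that by (auto simp: U_def)
  have "cylinder G A F x = Pi\<^sub>E (carrier G) U"
  proof (rule subset_antisym; rule subsetI)
    fix y assume "y \<in> cylinder G A F x"
    then show "y \<in> Pi\<^sub>E (carrier G) U"
      by (auto simp: cylinder_def configs_def U_def PiE_iff)
  next
    fix y assume y: "y \<in> Pi\<^sub>E (carrier G) U"
    then have "y \<in> configs G A" using UA by (fastforce simp: configs_def PiE_iff)
    moreover have "y g = x g" if "g \<in> F" for g
      using PiE_mem[OF y, of g] that assms(2) by (auto simp: U_def)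
    ultimately show "y \<in> cylinder G A F x" by (simp add: cylinder_def)
  qed
  moreover have "finite {i \<in> carrier G. U i \<noteq> A}"
    by (rule finite_subset[OF _ assms(1)]) (auto simp: U_def)
  ultimately show ?thesis
    using UA by (auto simp: prodiscrete_def openin_PiE_gen)
qed

text \<open>A basic box around \<open>x\<close> constrains finitely many coordinates; freezing
  exactly these at the values of \<open>x\<close> stays inside it.\<close>

lemma openin_prodiscrete_cylinder:
  assumes "openin (prodiscrete G A) U" "x \<in> U"
  obtains F where "finite F" "F \<subseteq> carrier G" "x \<in> configs G A" "cylinder G A F x \<subseteq> U"
proof -
  obtain W where W: "finite {i \<in> carrier G. W i \<noteq> A}" "x \<in> Pi\<^sub>E (carrier G) W"
    "Pi\<^sub>E (carrier G) W \<subseteq> U"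
    using assms unfolding prodiscrete_def openin_product_topology_alt topspace_discrete_topology
    by meson
  have "cylinder G A {i \<in> carrier G. W i \<noteq> A} x \<subseteq> Pi\<^sub>E (carrier G) W"
  proof
    fix y assume y: "y \<in> cylinder G A {i \<in> carrier G. W i \<noteq> A} x"
    show "y \<in> Pi\<^sub>E (carrier G) W"
    proof (rule PiE_I)
      fix g assume g: "g \<in> carrier G"
      show "y g \<in> W g"
      proof (cases "W g = A")
        case True
        then show ?thesis using y g by (auto simp: cylinder_def configs_def)
      next
        case False
        then show ?thesis using y g W(2) by (auto simp: cylinder_def)
      qed
    next
      fix g assume "g \<notin> carrier G"
      then show "y g = undefined" using y by (auto simp: cylinder_def configs_def)
    qed
  qed
  moreover have "x \<in> configs G A"
    using openin_subset[OF assms(1)] assms(2) by (auto simp: topspace_prodiscrete)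
  ultimately show thesis using that W by blast
qed

section \<open>Gluing of configurations, locality and closed image\<close>

locale finite_memory = group G for G (structure) +
  fixes A :: "'c set" and M
  assumes finite_alphabet: "finite A"
    and finite_memory: "finite M"
    and memory_carrier: "M \<subseteq> carrier G"
begin

text \<open>Plants the pattern of \<open>y\<close> on \<open>D\<close> at the translate by
  \<open>g\<close>. Only the values of \<open>y\<close> on \<open>D\<close> are read, so
  \<open>y\<close> may be a partial pattern; \<open>g = \<one>\<close> is plain gluing.\<close>

definition overwrite :: "'a \<Rightarrow> 'a set \<Rightarrow> ('a \<Rightarrow> 'c) \<Rightarrow> ('a \<Rightarrow> 'c) \<Rightarrow> 'a \<Rightarrow> 'c" where
  "overwrite g D y x =
     (\<lambda>h\<in>carrier G. if inv g \<otimes> h \<in> D then y (inv g \<otimes> h) else x h)"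

lemma overwrite_configs:
  assumes "\<And>d. d \<in> D \<Longrightarrow> y d \<in> A" "x \<in> configs G A"
  shows "overwrite g D y x \<in> configs G A"
  using assms by (auto simp: overwrite_def configs_def)

lemma overwrite_inside:
  assumes "g \<in> carrier G" "d \<in> D" "D \<subseteq> carrier G"
  shows "overwrite g D y x (g \<otimes> d) = y d"
proof -
  have "inv g \<otimes> (g \<otimes> d) = d" using assms by (auto simp: m_assoc[symmetric])
  then show ?thesis using assms by (auto simp: overwrite_def)
qed

lemma overwrite_outside:
  assumes "g \<in> carrier G" "h \<in> carrier G" "h \<notin> g <# D"
  shows "overwrite g D y x h = x h"
proof -
  have "h = g \<otimes> (inv g \<otimes> h)" using assms by (simp add: m_assoc[symmetric])
  then have "inv g \<otimes> h \<notin> D" using assms by (auto simp: l_coset_def)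
  then show ?thesis using assms by (simp add: overwrite_def)
qed

text \<open>Rules, configurations and cells may all differ between the two sides. Thus one statement
  covers dependence on a finite window, equivariance of a constant rule, and agreement of two rules
  at a cell.\<close>

lemma nuca_translate_cong:
  assumes "x \<in> configs G A" "y \<in> configs G A" "g \<in> carrier G" "h \<in> carrier G"
    and "s g = t h" "\<And>m. m \<in> M \<Longrightarrow> x (g \<otimes> m) = y (h \<otimes> m)"
  shows "nuca G A M s x g = nuca G A M t y h"
proof -
  have "(\<lambda>m\<in>M. x (g \<otimes> m)) = (\<lambda>m\<in>M. y (h \<otimes> m))" using assms by auto
  then show ?thesis
    using assms by (simp add: nuca_apply[OF group_axioms memory_carrier])
qed

lemma nuca_eq_on_imp_eq:
  assumes "s \<in> configs G (local_maps M A)" "x \<in> configs G A" "y \<in> configs G A"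
    and "\<And>g. g \<in> carrier G \<Longrightarrow> nuca G A M s x g = y g"
  shows "nuca G A M s x = y"
proof (rule PiE_ext)
  show "nuca G A M s x \<in> carrier G \<rightarrow>\<^sub>E A"
    using nuca_in_configs[OF group_axioms memory_carrier assms(1,2)] by (simp add: configs_def)
  show "y \<in> carrier G \<rightarrow>\<^sub>E A" using assms(3) by (simp add: configs_def)
qed (use assms in auto)

text \<open>Compactness: the sets \<open>C g\<close> of configurations with the correct value at
  \<open>g\<close> are closed and have empty intersection, hence so do finitely many of them. A
  configuration outside the image is therefore already excluded by a finite pattern.\<close>

lemma nuca_image_closed:
  assumes "s \<in> configs G (local_maps M A)" "y \<in> configs G A"
    and "y \<notin> nuca G A M s ` configs G A"
  obtains F where "finite F" "F \<subseteq> carrier G"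
    "\<And>x. x \<in> configs G A \<Longrightarrow> \<exists>g\<in>F. nuca G A M s x g \<noteq> y g"
proof -
  define C where "C g = {x \<in> configs G A. nuca G A M s x g = y g}" for g
  have closed: "closedin (prodiscrete G A) (C g)" if g: "g \<in> carrier G" for g
  proof -
    have "openin (prodiscrete G A) (configs G A - C g)"
    proof (subst openin_subopen, intro ballI)
      fix x assume x: "x \<in> configs G A - C g"
      have gM: "finite (g <# M)" "g <# M \<subseteq> carrier G"
        using g finite_memory memory_carrier by (auto simp: l_coset_def)
      \<comment> \<open>The value at \<open>g\<close> depends only on the coordinates in
        \<open>g <# M\<close>.\<close>
      have "cylinder G A (g <# M) x \<subseteq> configs G A - C g"
      proof
        fix z assume z: "z \<in> cylinder G A (g <# M) x"
        have "nuca G A M s z g = nuca G A M s x g"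
          using z x g by (intro nuca_translate_cong) (auto simp: cylinder_def l_coset_def)
        then show "z \<in> configs G A - C g" using x z by (auto simp: C_def cylinder_def)
      qed
      moreover have "x \<in> cylinder G A (g <# M) x" using x by (simp add: cylinder_def)
      ultimately show "\<exists>T. openin (prodiscrete G A) T \<and> x \<in> T \<and> T \<subseteq> configs G A - C g"
        using openin_cylinder[OF gM] x by blast
    qed
    then show ?thesis by (auto simp: closedin_def topspace_prodiscrete C_def)
  qed
  have compact: "compact_space (prodiscrete G A)"
    using finite_alphabet
    by (simp add: prodiscrete_def compact_space_product_topology compact_space_discrete_topology)
  have "\<Inter> (C ` carrier G) = {}"
  proof (rule ccontr)
    assume "\<Inter> (C ` carrier G) \<noteq> {}"
    then obtain x where x: "\<And>g. g \<in> carrier G \<Longrightarrow> x \<in> C g" by blast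
    then have "x \<in> configs G A" using one_closed by (auto simp: C_def)
    then have "nuca G A M s x = y" using assms x by (intro nuca_eq_on_imp_eq) (auto simp: C_def)
    then show False using assms \<open>x \<in> configs G A\<close> by blast
  qed
  then obtain \<F> where F: "finite \<F>" "\<F> \<subseteq> C ` carrier G" "\<Inter> \<F> = {}"
    using compact closed unfolding compact_space_fip by (metis (no_types, lifting) imageE)
  then obtain F where F: "finite F" "F \<subseteq> carrier G" "\<F> = C ` F"
    using finite_subset_image[of \<F> C "carrier G"] by metis
  have "\<exists>g\<in>F. nuca G A M s x g \<noteq> y g" if "x \<in> configs G A" for x
    using \<open>\<Inter> \<F> = {}\<close> that F by (auto simp: C_def)
  then show thesis using that F by blast
qed

section \<open>The Garden of Eden theorem for cellular automata\<close>

text \<open>Besides the cells where \<open>x\<close> and \<open>y\<close> differ, the hull contains every cell whose image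
  can see a difference, together with its whole neighbourhood.\<close>

definition difference_hull :: "('a \<Rightarrow> 'c) \<Rightarrow> ('a \<Rightarrow> 'c) \<Rightarrow> 'a set" where
  "difference_hull x y =
     (let \<Omega> = {g \<in> carrier G. x g \<noteq> y g}; B = \<Omega> <#> m_inv G ` M in \<Omega> \<union> B \<union> (B <#> M))"

lemma difference_hull_carrier: "difference_hull x y \<subseteq> carrier G"
  using memory_carrier by (auto simp: difference_hull_def Let_def set_mult_def)

lemma finite_difference_hull:
  assumes "asymptotic G x y"
  shows "finite (difference_hull x y)"
proof -
  obtain E where E: "finite E" "restrict x (carrier G - E) = restrict y (carrier G - E)"
    using assms by (auto simp: asymptotic_def)
  have "{g \<in> carrier G. x g \<noteq> y g} \<subseteq> E"
    using fun_cong[OF E(2)] by (fastforce simp: restrict_def split: if_splits)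
  then have "finite {g \<in> carrier G. x g \<noteq> y g}" using E(1) by (rule finite_subset)
  then show ?thesis
    using finite_memory by (auto simp: difference_hull_def Let_def set_mult_def)
qed

lemma difference_hull_differs:
  assumes "x \<in> configs G A" "y \<in> configs G A" "x \<noteq> y"
  obtains d where "d \<in> difference_hull x y" "x d \<noteq> y d"
proof -
  obtain d where "d \<in> carrier G" "x d \<noteq> y d"
    using assms PiE_ext[of x "carrier G" "\<lambda>_. A" y] by (auto simp: configs_def)
  then show thesis using that by (auto simp: difference_hull_def Let_def)
qed

text \<open>A cell whose window sees a difference between \<open>x\<close> and \<open>y\<close>
  lies, with its whole window, in the translated hull: there the rule is \<open>l\<close> and the
  window shows \<open>y\<close> after the change and \<open>x\<close> before it, so
  \<open>eq\<close> applies. At every other cell the window does not change at all.\<close>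

lemma nuca_overwrite_difference_hull:
  fixes x y :: "'a \<Rightarrow> 'c"
  defines "D \<equiv> difference_hull x y"
  assumes xy: "x \<in> configs G A" "y \<in> configs G A"
    and eq: "nuca G A M (\<lambda>_\<in>carrier G. l) x = nuca G A M (\<lambda>_\<in>carrier G. l) y"
    and s: "s \<in> configs G (local_maps M A)" "\<And>d. d \<in> D \<Longrightarrow> s (g \<otimes> d) = l"
    and g: "g \<in> carrier G" and u: "u \<in> configs G A" "\<And>d. d \<in> D \<Longrightarrow> u (g \<otimes> d) = x d"
  shows "nuca G A M s (overwrite g D y u) = nuca G A M s u"
proof (rule nuca_eq_on_imp_eq)
  let ?v = "overwrite g D y u"
  have DG: "D \<subseteq> carrier G" unfolding D_def by (rule difference_hull_carrier)
  show v: "?v \<in> configs G A"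
    using xy(2) u(1) DG by (intro overwrite_configs) (auto simp: configs_def)
  show "nuca G A M s u \<in> configs G A"
    using s(1) u(1) by (rule nuca_in_configs[OF group_axioms memory_carrier])
  fix h assume h: "h \<in> carrier G"
  define k where "k = inv g \<otimes> h"
  have k: "k \<in> carrier G" "h = g \<otimes> k" using g h by (auto simp: k_def m_assoc[symmetric])
  show "nuca G A M s ?v h = nuca G A M s u h"
  proof (cases "\<exists>m\<in>M. x (k \<otimes> m) \<noteq> y (k \<otimes> m)")
    case True
    then obtain m where m: "m \<in> M" "x (k \<otimes> m) \<noteq> y (k \<otimes> m)" by blast
    have mG: "m \<in> carrier G" using m memory_carrier by blast
    \<comment> \<open>This places \<open>k\<close> in the middle layer of the hull, and its window
      in the outer layer.\<close>
    have "k = (k \<otimes> m) \<otimes> inv m" using k mG by (simp add: m_assoc)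
    moreover have "k \<otimes> m \<in> {g \<in> carrier G. x g \<noteq> y g}" using m mG k by simp
    ultimately have "k \<in> {g \<in> carrier G. x g \<noteq> y g} <#> m_inv G ` M"
      using m(1) by (auto simp: set_mult_def)
    then have D: "k \<in> D" "\<And>m. m \<in> M \<Longrightarrow> k \<otimes> m \<in> D"
      by (auto simp: D_def difference_hull_def Let_def set_mult_def)
    have ass: "g \<otimes> k \<otimes> m = g \<otimes> (k \<otimes> m)" if "m \<in> M" for m
      using that memory_carrier g k by (auto simp: m_assoc)
    have l: "s h = l" using s(2) D(1) k by simp
    have "nuca G A M s ?v h = nuca G A M (\<lambda>_\<in>carrier G. l) y k"
      using v xy h k l D ass overwrite_inside[OF g _ DG]
      by (intro nuca_translate_cong) auto
    also have "\<dots> = nuca G A M (\<lambda>_\<in>carrier G. l) x k" by (simp add: eq)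
    also have "\<dots> = nuca G A M s u h"
      using u xy h k l D ass by (intro nuca_translate_cong) auto
    finally show ?thesis .
  next
    case False
    \<comment> \<open>Where the window meets the overwritten region, \<open>x\<close> and
      \<open>y\<close> agree, so the new value equals the old one.\<close>
    have "?v (h \<otimes> m) = u (h \<otimes> m)" if m: "m \<in> M" for m
    proof (cases "k \<otimes> m \<in> D")
      case True
      have "h \<otimes> m = g \<otimes> (k \<otimes> m)" using m memory_carrier g k by (auto simp: m_assoc)
      then show ?thesis using True False m u(2) overwrite_inside[OF g True DG] by simp
    next
      case kD: False
      have "inv g \<otimes> (h \<otimes> m) = k \<otimes> m" "h \<otimes> m \<in> carrier G"
        using m memory_carrier g h by (auto simp: k_def m_assoc)
      then show ?thesis using kD by (simp add: overwrite_def)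
    qed
    then show ?thesis using v u h by (intro nuca_translate_cong) auto
  qed
qed (use s u in auto)

lemma const_rule_configs:
  "l \<in> local_maps M A \<Longrightarrow> (\<lambda>_\<in>carrier G. l) \<in> configs G (local_maps M A)"
  by (simp add: configs_def)

text \<open>Extensional on the translate, so that an occurrence is a single equation of functions,
  as \<open>card_avoiding_patterns\<close> requires.\<close>

definition pattern_at :: "'a set \<Rightarrow> ('a \<Rightarrow> 'c) \<Rightarrow> 'a \<Rightarrow> 'a \<Rightarrow> 'c" where
  "pattern_at D x g = (\<lambda>h\<in>g <# D. x (inv g \<otimes> h))"

lemma restrict_eq_pattern_at:
  assumes "g \<in> carrier G" "D \<subseteq> carrier G"
  shows "restrict z (g <# D) = pattern_at D x g \<longleftrightarrow> (\<forall>d\<in>D. z (g \<otimes> d) = x d)"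
proof -
  have *: "inv g \<otimes> (g \<otimes> d) = d" if "d \<in> D" for d
    using assms that by (auto simp: m_assoc[symmetric])
  have "restrict z (g <# D) = pattern_at D x g \<longleftrightarrow> (\<forall>h\<in>g <# D. z h = x (inv g \<otimes> h))"
    unfolding pattern_at_def by (auto simp: restrict_def fun_eq_iff)
  also have "\<dots> \<longleftrightarrow> (\<forall>d\<in>D. z (g \<otimes> d) = x d)"
    using * by (auto simp: l_coset_def)
  finally show ?thesis .
qed

text \<open>Joins the entropy gap to the pattern count. The set \<open>N\<close> stays free because
  the two directions need different neighbourhoods of \<open>F\<close>: the cells that see
  \<open>F\<close>, and the cells that \<open>F\<close> sees.\<close>

lemma card_avoiding_translates_less:
  assumes "amenable TYPE('i) G" "finite D" "D \<subseteq> carrier G" "D \<noteq> {}"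
    and "finite N" "N \<subseteq> carrier G" "x \<in> configs G A"
  obtains F K T where "finite F" "F \<subseteq> carrier G" "K = F \<union> (F <#> N)" "finite K" "K \<subseteq> carrier G"
    "finite T" "T \<subseteq> carrier G" "\<And>t. t \<in> T \<Longrightarrow> t <# D \<subseteq> F" "disjoint_family_on (\<lambda>t. t <# D) T"
    "finite {z \<in> K \<rightarrow>\<^sub>E A. \<forall>t\<in>T. restrict z (t <# D) \<noteq> pattern_at D x t}"
    "card {z \<in> K \<rightarrow>\<^sub>E A. \<forall>t\<in>T. restrict z (t <# D) \<noteq> pattern_at D x t} < card (F \<rightarrow>\<^sub>E A)"
proof -
  have xA: "x g \<in> A" if "g \<in> carrier G" for g using that assms(7) by (auto simp: configs_def)
  \<comment> \<open>The alphabet is nonempty because it contains \<open>x \<one>\<close>.\<close>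
  then have "0 < card A" using finite_alphabet by (auto simp: card_gt_0_iff)
  then obtain F T where F: "finite F" "F \<subseteq> carrier G" and T: "finite T" "T \<subseteq> carrier G"
    "\<And>t. t \<in> T \<Longrightarrow> t <# D \<subseteq> F" "disjoint_family_on (\<lambda>t. t <# D) T"
    and less: "(card A ^ card D - 1) ^ card T * card A ^ (card (F \<union> (F <#> N)) - card D * card T)
      < card A ^ card F"
    using packing_entropy_gap[OF assms(1-6)] by metis
  define K where "K = F \<union> (F <#> N)"
  have K: "finite K" "K \<subseteq> carrier G" using F assms by (auto simp: K_def set_mult_def)
  have p: "pattern_at D x t \<in> (t <# D) \<rightarrow>\<^sub>E A" if "t \<in> T" for t
    unfolding pattern_at_def using that T(2) assms(3)
    by (intro restrict_PiE_iff[THEN iffD2] ballI xA) (auto simp: l_coset_def)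
  have "card {z \<in> K \<rightarrow>\<^sub>E A. \<forall>t\<in>T. restrict z (t <# D) \<noteq> pattern_at D x t}
      \<le> (card A ^ card D - 1) ^ card T * card A ^ (card K - card D * card T)"
    using card_avoiding_patterns[OF finite_alphabet T(1) K(1), of "\<lambda>t. t <# D" "card D" "pattern_at D x"]
      T p card_l_coset assms(3) unfolding K_def by blast
  also have "\<dots> < card (F \<rightarrow>\<^sub>E A)" using less F(1) by (simp add: K_def card_PiE)
  finally have "card {z \<in> K \<rightarrow>\<^sub>E A. \<forall>t\<in>T. restrict z (t <# D) \<noteq> pattern_at D x t} < card (F \<rightarrow>\<^sub>E A)" .
  moreover have "finite {z \<in> K \<rightarrow>\<^sub>E A. \<forall>t\<in>T. restrict z (t <# D) \<noteq> pattern_at D x t}"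
    by (rule finite_subset[OF _ finite_PiE[OF K(1)]]) (use finite_alphabet in auto)
  ultimately show thesis using that F K_def K T by blast
qed

text \<open>If \<open>y\<close> is not an image, some finite pattern of \<open>y\<close> occurs in
  no image at any position. Configurations that vary only on \<open>F\<close> then have fewer
  possible images on \<open>K\<close> than there are choices on \<open>F\<close>, so two of them
  share an image, against pre-injectivity.\<close>

lemma pre_injective_imp_surj:
  assumes amen: "amenable TYPE('i) G" and l: "l \<in> local_maps M A"
    and inj: "pre_injective_on G (nuca G A M (\<lambda>_\<in>carrier G. l)) (configs G A)"
  shows "configs G A \<subseteq> nuca G A M (\<lambda>_\<in>carrier G. l) ` configs G A"
proof
  define \<sigma> where "\<sigma> = nuca G A M (\<lambda>_\<in>carrier G. l)"
  fix y assume y: "y \<in> configs G A"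
  show "y \<in> nuca G A M (\<lambda>_\<in>carrier G. l) ` configs G A"
  proof (rule ccontr)
    assume "\<not> ?thesis"
    then obtain D where D: "finite D" "D \<subseteq> carrier G"
      and orphan: "\<And>x. x \<in> configs G A \<Longrightarrow> \<exists>g\<in>D. \<sigma> x g \<noteq> y g"
      using nuca_image_closed[OF const_rule_configs[OF l] y] unfolding \<sigma>_def by metis
    have ne: "D \<noteq> {}" using orphan[OF y] by blast
    have N: "finite (m_inv G ` M)" "m_inv G ` M \<subseteq> carrier G"
      using finite_memory memory_carrier by auto
    obtain F K T where F: "finite F" "F \<subseteq> carrier G"
      and K: "K = F \<union> (F <#> m_inv G ` M)" "finite K" "K \<subseteq> carrier G"
      and T: "finite T" "T \<subseteq> carrier G" "\<And>t. t \<in> T \<Longrightarrow> t <# D \<subseteq> F"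
        "disjoint_family_on (\<lambda>t. t <# D) T"
      and fin: "finite {z \<in> K \<rightarrow>\<^sub>E A. \<forall>t\<in>T. restrict z (t <# D) \<noteq> pattern_at D y t}"
      and less: "card {z \<in> K \<rightarrow>\<^sub>E A. \<forall>t\<in>T. restrict z (t <# D) \<noteq> pattern_at D y t} < card (F \<rightarrow>\<^sub>E A)"
      by (rule card_avoiding_translates_less[OF amen D ne N y]) (rule that)
    \<comment> \<open>The configuration \<open>y\<close> also serves as a fixed background outside
      \<open>F\<close>.\<close>
    define e where "e z = overwrite \<one> F z y" for z
    have e: "e z \<in> configs G A" if "z \<in> F \<rightarrow>\<^sub>E A" for z
      unfolding e_def using that y by (intro overwrite_configs) auto
    have e_in: "e z h = z h" if "h \<in> F" for z h
      using that F by (auto simp: e_def overwrite_def)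
    have e_out: "e z h = y h" if "h \<in> carrier G - F" for z h
      using that by (auto simp: e_def overwrite_def)
    have \<sigma>e: "\<sigma> (e z) \<in> configs G A" if "z \<in> F \<rightarrow>\<^sub>E A" for z
      unfolding \<sigma>_def using const_rule_configs[OF l] e[OF that]
      by (rule nuca_in_configs[OF group_axioms memory_carrier])
    have "(\<lambda>z. restrict (\<sigma> (e z)) K) ` (F \<rightarrow>\<^sub>E A)
        \<subseteq> {z \<in> K \<rightarrow>\<^sub>E A. \<forall>t\<in>T. restrict z (t <# D) \<noteq> pattern_at D y t}"
    proof clarify
      fix z assume z: "z \<in> F \<rightarrow>\<^sub>E A"
      have "restrict (restrict (\<sigma> (e z)) K) (t <# D) \<noteq> pattern_at D y t" if t: "t \<in> T" for t
      proof
        assume *: "restrict (restrict (\<sigma> (e z)) K) (t <# D) = pattern_at D y t"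
        have tG: "t \<in> carrier G" using t T by blast
        \<comment> \<open>Translating back by \<open>t\<close> moves the supposed occurrence to
          \<open>D\<close>, where \<open>orphan\<close> excludes it.\<close>
        define x where "x = (\<lambda>h\<in>carrier G. e z (t \<otimes> h))"
        have x: "x \<in> configs G A"
          using e[OF z] tG by (auto simp: x_def configs_def)
        obtain d where d: "d \<in> D" "\<sigma> x d \<noteq> y d" using orphan[OF x] by blast
        have dG: "d \<in> carrier G" using d D by blast
        have "\<sigma> x d = \<sigma> (e z) (t \<otimes> d)"
          unfolding \<sigma>_def using x e[OF z] dG tG memory_carrier
          by (intro nuca_translate_cong) (auto simp: x_def m_assoc)
        moreover have "restrict (\<sigma> (e z)) K (t \<otimes> d) = y d"
          using * d(1) restrict_eq_pattern_at[OF tG D(2)] by blast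
        moreover have "t \<otimes> d \<in> K" using T(3)[OF t] d K by (auto simp: l_coset_def)
        ultimately show False using d by simp
      qed
      moreover have "restrict (\<sigma> (e z)) K \<in> K \<rightarrow>\<^sub>E A"
        using \<sigma>e[OF z] K by (auto simp: configs_def)
      ultimately show "restrict (\<sigma> (e z)) K \<in> K \<rightarrow>\<^sub>E A \<and>
          (\<forall>t\<in>T. restrict (restrict (\<sigma> (e z)) K) (t <# D) \<noteq> pattern_at D y t)" by blast
    qed
    then have "\<not> inj_on (\<lambda>z. restrict (\<sigma> (e z)) K) (F \<rightarrow>\<^sub>E A)"
      using card_inj_on_le[OF _ _ fin] less linorder_not_le by blast
    then obtain z z' where z: "z \<in> F \<rightarrow>\<^sub>E A" "z' \<in> F \<rightarrow>\<^sub>E A" "z \<noteq> z'"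
      and eq: "restrict (\<sigma> (e z)) K = restrict (\<sigma> (e z')) K"
      by (auto simp: inj_on_def)
    have "\<sigma> (e z) = \<sigma> (e z')"
      unfolding \<sigma>_def
    proof (rule nuca_eq_on_imp_eq[OF const_rule_configs[OF l] e[OF z(1)]])
      show "nuca G A M (\<lambda>_\<in>carrier G. l) (e z') \<in> configs G A"
        using \<sigma>e[OF z(2)] by (simp add: \<sigma>_def)
      fix h assume h: "h \<in> carrier G"
      show "nuca G A M (\<lambda>_\<in>carrier G. l) (e z) h = nuca G A M (\<lambda>_\<in>carrier G. l) (e z') h"
      proof (cases "h \<in> K")
        case True
        then show ?thesis using fun_cong[OF eq, of h] by (simp add: \<sigma>_def)
      next
        case False
        \<comment> \<open>Outside \<open>K\<close> no window meets \<open>F\<close>, so the two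
          images agree there as well.\<close>
        have "h \<otimes> m \<in> carrier G - F" if m: "m \<in> M" for m
        proof -
          have mG: "m \<in> carrier G" using m memory_carrier by blast
          have "h = (h \<otimes> m) \<otimes> inv m" using h mG by (simp add: m_assoc)
          then have "h \<otimes> m \<notin> F" using False m by (auto simp: K set_mult_def)
          then show ?thesis using h mG by simp
        qed
        then show ?thesis
          using h e[OF z(1)] e[OF z(2)] by (intro nuca_translate_cong) (auto simp: e_out)
      qed
    qed
    moreover have "asymptotic G (e z) (e z')"
      unfolding asymptotic_def using F e_out by (intro exI[of _ F]) (auto simp: restrict_def)
    ultimately have "e z = e z'"
      using inj e z unfolding pre_injective_on_def \<sigma>_def by blast
    then have "z = z'" using z(1,2) e_in by (metis PiE_ext)
    then show False using z by blast
  qed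
qed

text \<open>If \<open>x\<close> and \<open>y\<close> violate pre-injectivity, every occurrence of
  \<open>x\<close> on a translate of \<open>D\<close> can be exchanged for \<open>y\<close> without
  changing the image. So configurations avoiding \<open>x\<close> on the packing still reach every
  pattern on \<open>F\<close>, although too few restrictions to \<open>K\<close> are
  available.\<close>

lemma surj_imp_pre_injective:
  assumes amen: "amenable TYPE('i) G" and l: "l \<in> local_maps M A"
    and surj: "configs G A \<subseteq> nuca G A M (\<lambda>_\<in>carrier G. l) ` configs G A"
  shows "pre_injective_on G (nuca G A M (\<lambda>_\<in>carrier G. l)) (configs G A)"
proof (rule ccontr)
  define \<sigma> where "\<sigma> = nuca G A M (\<lambda>_\<in>carrier G. l)"
  assume "\<not> ?thesis"
  then obtain x y where xy: "x \<in> configs G A" "y \<in> configs G A" "asymptotic G x y" "x \<noteq> y"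
    and \<sigma>xy: "\<sigma> x = \<sigma> y"
    by (auto simp: pre_injective_on_def \<sigma>_def)
  define D where "D = difference_hull x y"
  have D: "finite D" "D \<subseteq> carrier G"
    unfolding D_def using xy by (auto simp: finite_difference_hull difference_hull_carrier[THEN subsetD])
  obtain d where d: "d \<in> D" "x d \<noteq> y d"
    using difference_hull_differs[OF xy(1,2,4)] by (auto simp: D_def)
  then have ne: "D \<noteq> {}" by blast
  obtain F K T where F: "finite F" "F \<subseteq> carrier G"
    and K: "K = F \<union> (F <#> M)" "finite K" "K \<subseteq> carrier G"
    and T: "finite T" "T \<subseteq> carrier G" "\<And>t. t \<in> T \<Longrightarrow> t <# D \<subseteq> F"
      "disjoint_family_on (\<lambda>t. t <# D) T"
    and fin: "finite {z \<in> K \<rightarrow>\<^sub>E A. \<forall>t\<in>T. restrict z (t <# D) \<noteq> pattern_at D x t}"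
    and less: "card {z \<in> K \<rightarrow>\<^sub>E A. \<forall>t\<in>T. restrict z (t <# D) \<noteq> pattern_at D x t} < card (F \<rightarrow>\<^sub>E A)"
    by (rule card_avoiding_translates_less[OF amen D ne finite_memory memory_carrier xy(1)]) (rule that)
  define S where "S = {z \<in> K \<rightarrow>\<^sub>E A. \<forall>t\<in>T. restrict z (t <# D) \<noteq> pattern_at D x t}"
  \<comment> \<open>Occurrences are exchanged one position at a time; disjointness of the translates
    protects the positions already treated.\<close>
  have avoid: "\<exists>v\<in>configs G A. \<sigma> v = \<sigma> u \<and> (\<forall>t\<in>T'. \<exists>d\<in>D. v (t \<otimes> d) \<noteq> x d)"
    if "finite T'" "T' \<subseteq> T" "u \<in> configs G A" for u T'
    using that(1,2)
  proof (induction T' rule: finite_induct)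
    case empty
    then show ?case using that(3) by blast
  next
    case (insert t T')
    then obtain v where v: "v \<in> configs G A" "\<sigma> v = \<sigma> u" "\<And>t. t \<in> T' \<Longrightarrow> \<exists>d\<in>D. v (t \<otimes> d) \<noteq> x d"
      by auto
    have t: "t \<in> T" "t \<in> carrier G" using insert.prems T by auto
    show ?case
    proof (cases "\<exists>d\<in>D. v (t \<otimes> d) \<noteq> x d")
      case True
      then show ?thesis using v by blast
    next
      case False
      let ?w = "overwrite t D y v"
      have "?w \<in> configs G A"
        using v xy D by (intro overwrite_configs) (auto simp: configs_def)
      moreover have "\<sigma> ?w = \<sigma> v"
        unfolding \<sigma>_def D_def
      proof (rule nuca_overwrite_difference_hull[OF xy(1,2) _ const_rule_configs[OF l] _ t(2) v(1)])
        show "nuca G A M (\<lambda>_\<in>carrier G. l) x = nuca G A M (\<lambda>_\<in>carrier G. l) y"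
          using \<sigma>xy by (simp add: \<sigma>_def)
      qed (use False t D(2) in \<open>auto simp: D_def dest: subsetD\<close>)
      moreover have "\<exists>d\<in>D. ?w (r \<otimes> d) \<noteq> x d" if r: "r \<in> insert t T'" for r
      proof (cases "r = t")
        case True
        then show ?thesis using d overwrite_inside[OF t(2) d(1) D(2)] by (intro bexI[OF _ d(1)]) simp
      next
        case False
        then have rT: "r \<in> T'" "r \<in> T" "r \<in> carrier G" using r insert.prems T by auto
        then obtain d' where d': "d' \<in> D" "v (r \<otimes> d') \<noteq> x d'" using v(3) by blast
        have "r \<otimes> d' \<in> r <# D" using d' by (auto simp: l_coset_def)
        moreover have "(r <# D) \<inter> (t <# D) = {}"
          using T(4) rT t False by (auto simp: disjoint_family_on_def)
        ultimately have "?w (r \<otimes> d') = v (r \<otimes> d')"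
          using t rT d' D by (intro overwrite_outside) auto
        then show ?thesis using d' by metis
      qed
      ultimately show ?thesis using v(2) by metis
    qed
  qed
  \<comment> \<open>Images on \<open>F\<close> depend only on the cells of \<open>K\<close>, so
    filling the rest with \<open>x\<close> does no harm.\<close>
  define \<Psi> where "\<Psi> z = restrict (\<sigma> (overwrite \<one> K z x)) F" for z
  have "F \<rightarrow>\<^sub>E A \<subseteq> \<Psi> ` S"
  proof
    fix w assume w: "w \<in> F \<rightarrow>\<^sub>E A"
    have "overwrite \<one> F w x \<in> configs G A"
      using w xy by (intro overwrite_configs) auto
    then obtain u where u: "u \<in> configs G A" "overwrite \<one> F w x = \<sigma> u"
      using surj by (auto simp: \<sigma>_def)
    obtain v where v: "v \<in> configs G A" "\<sigma> v = \<sigma> u" "\<And>t. t \<in> T \<Longrightarrow> \<exists>d\<in>D. v (t \<otimes> d) \<noteq> x d"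
      using avoid[OF T(1) subset_refl u(1)] by blast
    define z where "z = restrict v K"
    have zK: "z \<in> K \<rightarrow>\<^sub>E A" using v K by (auto simp: z_def configs_def)
    have "restrict z (t <# D) \<noteq> pattern_at D x t" if t: "t \<in> T" for t
    proof -
      have tG: "t \<in> carrier G" using t T by blast
      have "z (t \<otimes> d) = v (t \<otimes> d)" if "d \<in> D" for d
        using T(3)[OF t] that K by (auto simp: z_def l_coset_def)
      then show ?thesis using v(3)[OF t] restrict_eq_pattern_at[OF tG D(2)] by auto
    qed
    then have zS: "z \<in> S" using zK by (simp add: S_def)
    have e: "overwrite \<one> K z x \<in> configs G A"
      using zK xy by (intro overwrite_configs) auto
    have eK: "overwrite \<one> K z x k = v k" if "k \<in> K" for k
      using that K by (auto simp: overwrite_def z_def)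
    have "\<Psi> z f = w f" if f: "f \<in> F" for f
    proof -
      have fG: "f \<in> carrier G" using f F by blast
      have "\<sigma> (overwrite \<one> K z x) f = \<sigma> v f"
        unfolding \<sigma>_def using e v(1) fG f K
        by (intro nuca_translate_cong eK) (auto simp: set_mult_def)
      also have "\<dots> = overwrite \<one> F w x f" using u v by simp
      also have "\<dots> = w f" using f fG by (simp add: overwrite_def)
      finally show ?thesis using f by (simp add: \<Psi>_def)
    qed
    moreover have "\<Psi> z f = w f" if "f \<notin> F" for f
      using that w by (auto simp: \<Psi>_def)
    ultimately have "\<Psi> z = w" by blast
    then show "w \<in> \<Psi> ` S" using zS by blast
  qed
  moreover have "finite S" using fin by (simp only: S_def)
  ultimately have "card (F \<rightarrow>\<^sub>E A) \<le> card S" by (metis surj_card_le)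
  then show False using less by (simp add: S_def)
qed

section \<open>Perturbing the rule on a finite set\<close>

context
  fixes s l E
  assumes s: "s \<in> configs G (local_maps M A)" and l: "l \<in> local_maps M A"
    and E: "finite E" "E \<subseteq> carrier G" "\<And>g. g \<in> carrier G \<Longrightarrow> g \<notin> E \<Longrightarrow> s g = l"
begin

text \<open>A colliding pair for the constant rule is planted in a point of \<open>U\<close>, away
  from the cells fixing a cylinder inside \<open>U\<close> and away from \<open>E\<close>. Both
  results stay in \<open>U\<close>, and near the planted hull \<open>s\<close> acts as
  \<open>l\<close>.\<close>

lemma pre_injective_open_imp_pre_injective_const:
  assumes inf: "infinite (carrier G)"
    and U: "openin (prodiscrete G A) U" "U \<noteq> {}" "pre_injective_on G (nuca G A M s) U"
  shows "pre_injective_on G (nuca G A M (\<lambda>_\<in>carrier G. l)) (configs G A)"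
  unfolding pre_injective_on_def
proof (intro ballI impI, rule ccontr)
  fix x y
  assume xy: "x \<in> configs G A" "y \<in> configs G A" "asymptotic G x y" "x \<noteq> y"
    and eq: "nuca G A M (\<lambda>_\<in>carrier G. l) x = nuca G A M (\<lambda>_\<in>carrier G. l) y"
  obtain x0 where x0: "x0 \<in> U" using U(2) by blast
  obtain F where F: "finite F" "F \<subseteq> carrier G" "x0 \<in> configs G A" "cylinder G A F x0 \<subseteq> U"
    by (rule openin_prodiscrete_cylinder[OF U(1) x0])
  define D where "D = difference_hull x y"
  have D: "finite D" "D \<subseteq> carrier G"
    unfolding D_def using finite_difference_hull[OF xy(3)] difference_hull_carrier by auto
  obtain d where d: "d \<in> D" "x d \<noteq> y d"
    using difference_hull_differs[OF xy(1,2,4)] by (auto simp: D_def)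
  obtain g where g: "g \<in> carrier G" "\<And>d. d \<in> D \<Longrightarrow> g \<otimes> d \<notin> F \<union> E"
    using infinite_translate_disjoint[OF inf D, of "F \<union> E"] F E by auto
  have disj: "h \<notin> g <# D" if "h \<in> F" for h using that g by (auto simp: l_coset_def)
  define u where "u = overwrite g D x x0"
  define v where "v = overwrite g D y u"
  have u: "u \<in> configs G A"
    unfolding u_def using xy F D by (intro overwrite_configs) (auto simp: configs_def)
  then have v: "v \<in> configs G A"
    unfolding v_def using xy D by (intro overwrite_configs) (auto simp: configs_def)
  have out: "v h = u h" "u h = x0 h" if "h \<in> carrier G" "h \<notin> g <# D" for h
    using that g by (auto simp: u_def v_def overwrite_outside)
  have "u h = x0 h \<and> v h = x0 h" if "h \<in> F" for h
    using out[OF _ disj[OF that]] that F(2) by auto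
  then have "u \<in> U" "v \<in> U" using u v F(4) by (auto simp: cylinder_def)
  moreover have "asymptotic G v u"
    unfolding asymptotic_def
  proof (intro exI conjI)
    show "finite (g <# D)" "g <# D \<subseteq> carrier G" using D g by (auto simp: l_coset_def)
    show "restrict v (carrier G - (g <# D)) = restrict u (carrier G - (g <# D))"
      using out by (auto simp: restrict_def)
  qed
  moreover have "nuca G A M s v = nuca G A M s u"
    unfolding v_def D_def
  proof (rule nuca_overwrite_difference_hull[OF xy(1,2) eq s _ g(1) u])
    fix d assume "d \<in> difference_hull x y"
    then have d: "d \<in> D" by (simp add: D_def)
    show "s (g \<otimes> d) = l" using E(3) g d D by auto
    show "u (g \<otimes> d) = x d" unfolding u_def by (rule overwrite_inside[OF g(1) d D(2)])
  qed
  ultimately have "v = u" using U(3) by (auto simp: pre_injective_on_def)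
  moreover have "u (g \<otimes> d) = x d" "v (g \<otimes> d) = y d"
    unfolding u_def v_def by (rule overwrite_inside[OF g(1) d(1) D(2)])+
  ultimately show False using d by simp
qed

text \<open>Fixing the configuration on \<open>E <#> M\<close> makes all windows at cells of
  \<open>E\<close> equal, so any rule gives equal values there. Off \<open>E\<close> the two rules
  coincide, hence equal images under \<open>s\<close> yield equal images under the constant
  rule.\<close>

lemma pre_injective_const_imp_pre_injective_open:
  assumes inj: "pre_injective_on G (nuca G A M (\<lambda>_\<in>carrier G. l)) (configs G A)"
    and x0: "x0 \<in> configs G A"
  obtains U where "openin (prodiscrete G A) U" "U \<noteq> {}" "pre_injective_on G (nuca G A M s) U"
proof
  define F where "F = E <#> M"
  have "finite F" "F \<subseteq> carrier G"
    using E finite_memory memory_carrier by (auto simp: F_def set_mult_def)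
  then show "openin (prodiscrete G A) (cylinder G A F x0)" using x0 by (rule openin_cylinder)
  show "cylinder G A F x0 \<noteq> {}" using x0 by (auto simp: cylinder_def)
  show "pre_injective_on G (nuca G A M s) (cylinder G A F x0)"
    unfolding pre_injective_on_def
  proof (intro ballI impI)
    fix x y assume x: "x \<in> cylinder G A F x0" and y: "y \<in> cylinder G A F x0"
      and as: "asymptotic G x y" and eq: "nuca G A M s x = nuca G A M s y"
    have xy: "x \<in> configs G A" "y \<in> configs G A" using x y by (auto simp: cylinder_def)
    have "nuca G A M (\<lambda>_\<in>carrier G. l) x = nuca G A M (\<lambda>_\<in>carrier G. l) y"
    proof (rule nuca_eq_on_imp_eq[OF const_rule_configs[OF l] xy(1)])
      show "nuca G A M (\<lambda>_\<in>carrier G. l) y \<in> configs G A"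
        using const_rule_configs[OF l] xy(2) by (rule nuca_in_configs[OF group_axioms memory_carrier])
      fix g assume g: "g \<in> carrier G"
      show "nuca G A M (\<lambda>_\<in>carrier G. l) x g = nuca G A M (\<lambda>_\<in>carrier G. l) y g"
      proof (cases "g \<in> E")
        case True
        then have "x (g \<otimes> m) = y (g \<otimes> m)" if "m \<in> M" for m
          using that x y by (auto simp: cylinder_def F_def set_mult_def)
        then show ?thesis using xy g by (intro nuca_translate_cong) auto
      next
        case False
        have "nuca G A M (\<lambda>_\<in>carrier G. l) z g = nuca G A M s z g" if "z \<in> configs G A" for z
          using that g E(3) False by (intro nuca_translate_cong) auto
        then show ?thesis using xy eq by simp
      qed
    qed
    then show "x = y" using inj xy as by (auto simp: pre_injective_on_def)
  qed
qed

text \<open>A finite Baire argument: were every cylinder to leave the image, cylinders could be shrunk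
  successively so as to exclude each of the finitely many possible values on \<open>E\<close>.\<close>

lemma surj_const_imp_image_open:
  assumes surj: "configs G A \<subseteq> nuca G A M (\<lambda>_\<in>carrier G. l) ` configs G A"
    and x0: "x0 \<in> configs G A"
  obtains V where "openin (prodiscrete G A) V" "V \<noteq> {}" "V \<subseteq> nuca G A M s ` configs G A"
proof (rule ccontr)
  let ?Im = "nuca G A M s ` configs G A"
  assume "\<not> thesis"
  with that have no_open: "\<And>V. openin (prodiscrete G A) V \<Longrightarrow> V \<noteq> {} \<Longrightarrow> \<not> V \<subseteq> ?Im"
    by blast
  \<comment> \<open>The set \<open>Q\<close> collects the patterns on \<open>E\<close> already
    excluded. The values of \<open>w\<close> are prescribed only off \<open>E\<close>, so that all
    of \<open>Q\<close> is excluded by the same condition.\<close>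
  have exclude: "\<exists>w F. w \<in> configs G A \<and> finite F \<and> F \<subseteq> carrier G \<and>
      (\<forall>p\<in>Q. \<forall>y\<in>configs G A. (\<forall>g\<in>F - E. y g = w g) \<longrightarrow> (\<forall>g\<in>E. y g = p g) \<longrightarrow> y \<notin> ?Im)"
    if "finite Q" "Q \<subseteq> E \<rightarrow>\<^sub>E A" for Q
    using that
  proof (induction Q rule: finite_induct)
    case empty
    then show ?case using x0 by blast
  next
    case (insert p Q)
    then obtain w F where w: "w \<in> configs G A" and F: "finite F" "F \<subseteq> carrier G"
      and IH: "\<And>p y. \<lbrakk>p \<in> Q; y \<in> configs G A; \<And>g. g \<in> F - E \<Longrightarrow> y g = w g; \<And>g. g \<in> E \<Longrightarrow> y g = p g\<rbrakk>
        \<Longrightarrow> y \<notin> ?Im"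
      by auto
    define w' where "w' = overwrite \<one> E p w"
    have w': "w' \<in> configs G A"
      unfolding w'_def using insert.prems w by (intro overwrite_configs) auto
    have w'_val: "w' g = (if g \<in> E then p g else w g)" if "g \<in> carrier G" for g
      using that by (auto simp: w'_def overwrite_def)
    have "openin (prodiscrete G A) (cylinder G A (F \<union> E) w')"
      using F E w' by (intro openin_cylinder) auto
    moreover have "w' \<in> cylinder G A (F \<union> E) w'" using w' by (simp add: cylinder_def)
    \<comment> \<open>The point \<open>y0\<close> shows \<open>p\<close> on \<open>E\<close> and
      agrees with \<open>w\<close> on \<open>F - E\<close>. The earlier exclusions persist, and
      closedness of the image excludes \<open>p\<close> after finitely many further cells are
      fixed.\<close>
    ultimately obtain y0 where y0: "y0 \<in> cylinder G A (F \<union> E) w'" "y0 \<notin> ?Im"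
      using no_open by blast
    then have y0c: "y0 \<in> configs G A" by (simp add: cylinder_def)
    obtain F' where F': "finite F'" "F' \<subseteq> carrier G"
      and miss: "\<And>x. x \<in> configs G A \<Longrightarrow> \<exists>g\<in>F'. nuca G A M s x g \<noteq> y0 g"
      using nuca_image_closed[OF s y0c y0(2)] by blast
    have y0_val: "y0 g = (if g \<in> E then p g else w g)" if "g \<in> F \<union> E" for g
    proof -
      have "y0 g = w' g" using that y0 by (auto simp: cylinder_def)
      then show ?thesis using that F E w'_val by auto
    qed
    have "y \<notin> ?Im" if q: "q \<in> insert p Q" and y: "y \<in> configs G A"
      and off: "\<forall>g\<in>(F \<union> F') - E. y g = y0 g" and on: "\<forall>g\<in>E. y g = q g" for q y
    proof (cases "q \<in> Q")
      case True
      show ?thesis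
        using off on y0_val by (intro IH[OF True y]) auto
    next
      case False
      then have "q = p" using q by simp
      then have "y g = y0 g" if "g \<in> F'" for g
        using that off on y0_val by (cases "g \<in> E") auto
      then show ?thesis using miss by fastforce
    qed
    then show ?case using y0c F F' by (intro exI[of _ y0] exI[of _ "F \<union> F'"]) auto
  qed
  have "finite (E \<rightarrow>\<^sub>E A)" using E finite_alphabet by (simp add: finite_PiE)
  from exclude[OF this subset_refl] obtain w F where w: "w \<in> configs G A" and F: "F \<subseteq> carrier G"
    and no: "\<forall>p\<in>E \<rightarrow>\<^sub>E A. \<forall>y\<in>configs G A.
      (\<forall>g\<in>F - E. y g = w g) \<longrightarrow> (\<forall>g\<in>E. y g = p g) \<longrightarrow> y \<notin> ?Im"
    by blast
  \<comment> \<open>A preimage of \<open>w\<close> under the constant rule has, under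
    \<open>s\<close>, an image equal to \<open>w\<close> off \<open>E\<close>. Its pattern on
    \<open>E\<close> is among those excluded, a contradiction.\<close>
  obtain x where x: "x \<in> configs G A" "w = nuca G A M (\<lambda>_\<in>carrier G. l) x" using surj w by blast
  have \<tau>x: "nuca G A M s x \<in> configs G A"
    using s x(1) by (rule nuca_in_configs[OF group_axioms memory_carrier])
  have "nuca G A M s x \<notin> ?Im"
  proof (rule no[rule_format, OF _ \<tau>x])
    show "restrict (nuca G A M s x) E \<in> E \<rightarrow>\<^sub>E A" using \<tau>x E by (auto simp: configs_def)
    fix g assume "g \<in> F - E"
    then show "nuca G A M s x g = w g"
      unfolding x(2) using F E(3) x(1) by (intro nuca_translate_cong) auto
  qed simp
  then show False using x by blast
qed

text \<open>A finite pattern missed by the constant rule is planted in a point of \<open>V\<close>,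
  away from a defining set of cells and from \<open>E\<close>. The result lies in \<open>V\<close>
  and has a preimage under \<open>s\<close>; moved back by \<open>g\<close>, that preimage produces
  the missed pattern under the constant rule.\<close>

lemma image_open_imp_surj_const:
  assumes inf: "infinite (carrier G)"
    and V: "openin (prodiscrete G A) V" "V \<noteq> {}" "V \<subseteq> nuca G A M s ` configs G A"
  shows "configs G A \<subseteq> nuca G A M (\<lambda>_\<in>carrier G. l) ` configs G A"
proof
  fix y assume y: "y \<in> configs G A"
  obtain x0 where x0: "x0 \<in> V" using V(2) by blast
  obtain F where F: "finite F" "F \<subseteq> carrier G" "x0 \<in> configs G A" "cylinder G A F x0 \<subseteq> V"
    by (rule openin_prodiscrete_cylinder[OF V(1) x0])
  show "y \<in> nuca G A M (\<lambda>_\<in>carrier G. l) ` configs G A"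
  proof (rule ccontr)
    assume "\<not> ?thesis"
    then obtain D where D: "finite D" "D \<subseteq> carrier G"
      and orphan: "\<And>x. x \<in> configs G A \<Longrightarrow> \<exists>g\<in>D. nuca G A M (\<lambda>_\<in>carrier G. l) x g \<noteq> y g"
      using nuca_image_closed[OF const_rule_configs[OF l] y] by blast
    obtain g where g: "g \<in> carrier G" "\<And>d. d \<in> D \<Longrightarrow> g \<otimes> d \<notin> F \<union> E"
      using infinite_translate_disjoint[OF inf D, of "F \<union> E"] F E by auto
    define v where "v = overwrite g D y x0"
    have "v \<in> configs G A"
      unfolding v_def using y F D by (intro overwrite_configs) (auto simp: configs_def)
    moreover have "v h = x0 h" if h: "h \<in> F" for h
    proof -
      have "h \<notin> g <# D" using h g by (auto simp: l_coset_def)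
      then show ?thesis unfolding v_def using h F g by (intro overwrite_outside) auto
    qed
    ultimately have "v \<in> V" using F by (auto simp: cylinder_def)
    then obtain u where u: "u \<in> configs G A" "v = nuca G A M s u" using V by blast
    define x where "x = (\<lambda>h\<in>carrier G. u (g \<otimes> h))"
    have x: "x \<in> configs G A" using u g by (auto simp: x_def configs_def)
    have "nuca G A M (\<lambda>_\<in>carrier G. l) x d = y d" if d: "d \<in> D" for d
    proof -
      have dG: "d \<in> carrier G" using d D by blast
      have "nuca G A M (\<lambda>_\<in>carrier G. l) x d = nuca G A M s u (g \<otimes> d)"
        using x u dG g(1) g(2)[OF d] E(3) memory_carrier
        by (intro nuca_translate_cong) (auto simp: x_def m_assoc)
      also have "\<dots> = y d"
        unfolding u(2)[symmetric] v_def by (rule overwrite_inside[OF g(1) d D(2)])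
      finally show ?thesis .
    qed
    then show False using orphan[OF x] by blast
  qed
qed

end

end

section \<open>The equivalence, for finite and for infinite groups\<close>

theorem theorem1:
  fixes G :: "('g, 'b) monoid_scheme"
    and A :: "'a set"
    and \<tau> :: "('g \<Rightarrow> 'a) \<Rightarrow> 'g \<Rightarrow> 'a"
  assumes "group G"
    and "amenable TYPE('i) G"
    and "finite A"
    and "\<tau> \<in> NUCA_c G A"
  shows "(\<exists>U. openin (prodiscrete G A) U \<and> U \<noteq> {} \<and> pre_injective_on G \<tau> U) \<longleftrightarrow>
         (\<exists>V. openin (prodiscrete G A) V \<and> V \<noteq> {} \<and> V \<subseteq> \<tau> ` configs G A)"
proof (cases "configs G A = {}")
  \<comment> \<open>Without configurations the only open set is empty and both sides are
    false.\<close>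
  case True
  then have "U = {}" if "openin (prodiscrete G A) U" for U
    using openin_subset[OF that] by (simp add: topspace_prodiscrete)
  then show ?thesis by blast
next
  case False
  then obtain x0 where x0: "x0 \<in> configs G A" by blast
  obtain M s where M: "finite M" "M \<subseteq> carrier G" and s: "s \<in> configs G (local_maps M A)"
    and \<tau>: "\<tau> = nuca G A M s" and "asymptotically_constant G (local_maps M A) s"
    using assms(4) by (auto simp: NUCA_c_def)
  then obtain l E where l: "l \<in> local_maps M A" and E: "finite E" "E \<subseteq> carrier G"
    and sE: "restrict s (carrier G - E) = restrict (\<lambda>_\<in>carrier G. l) (carrier G - E)"
    by (auto simp: asymptotically_constant_def asymptotic_def)
  have sl: "s g = l" if "g \<in> carrier G" "g \<notin> E" for g
    using fun_cong[OF sE, of g] that by simp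
  interpret finite_memory G A M
    using assms(1,3) M by (simp add: finite_memory_def finite_memory_axioms_def)
  show ?thesis
  proof (cases "finite (carrier G)")
    case True
    \<comment> \<open>In a finite group a cylinder may fix every cell, so one-point sets witness
      both sides.\<close>
    have singleton: "openin (prodiscrete G A) {x}" if x: "x \<in> configs G A" for x
    proof -
      have "cylinder G A (carrier G) x = {x}"
        using x by (auto simp: cylinder_def configs_def intro: PiE_ext)
      then show ?thesis using openin_cylinder[OF True subset_refl x] by simp
    qed
    have "\<tau> x0 \<in> configs G A"
      unfolding \<tau> using s x0 by (rule nuca_in_configs[OF group_axioms memory_carrier])
    then have "openin (prodiscrete G A) {\<tau> x0}" "{\<tau> x0} \<subseteq> \<tau> ` configs G A"
      using singleton x0 by auto
    moreover have "pre_injective_on G \<tau> {x0}" by (simp add: pre_injective_on_def)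
    ultimately show ?thesis using singleton[OF x0] by blast
  next
    case False
    show ?thesis
    proof
      assume "\<exists>U. openin (prodiscrete G A) U \<and> U \<noteq> {} \<and> pre_injective_on G \<tau> U"
      then have "pre_injective_on G (nuca G A M (\<lambda>_\<in>carrier G. l)) (configs G A)"
        using pre_injective_open_imp_pre_injective_const[OF s l E sl False] \<tau> by blast
      then have surj: "configs G A \<subseteq> nuca G A M (\<lambda>_\<in>carrier G. l) ` configs G A"
        by (rule pre_injective_imp_surj[OF assms(2) l])
      show "\<exists>V. openin (prodiscrete G A) V \<and> V \<noteq> {} \<and> V \<subseteq> \<tau> ` configs G A"
        by (rule surj_const_imp_image_open[OF s l E sl surj x0]) (auto simp: \<tau>)
    next
      assume "\<exists>V. openin (prodiscrete G A) V \<and> V \<noteq> {} \<and> V \<subseteq> \<tau> ` configs G A"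
      then have "configs G A \<subseteq> nuca G A M (\<lambda>_\<in>carrier G. l) ` configs G A"
        using image_open_imp_surj_const[OF s l E sl False] \<tau> by blast
      then have inj: "pre_injective_on G (nuca G A M (\<lambda>_\<in>carrier G. l)) (configs G A)"
        by (rule surj_imp_pre_injective[OF assms(2) l])
      show "\<exists>U. openin (prodiscrete G A) U \<and> U \<noteq> {} \<and> pre_injective_on G \<tau> U"
        by (rule pre_injective_const_imp_pre_injective_open[OF s l E sl inj x0]) (auto simp: \<tau>)
    qed
  qed
qed

end
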